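(* Let $A$ be a finite set of size greater than $1$ and let $\mathbf{B}=(B,\mathcal{F})$ be a finite algebra with an $n$-ary NU-term, $n\ge 3$. Let $C$ be a clonoid with source set $A$ and target algebra $\mathbf{B}$. Then \[C=\mathrm{Pol}\bigl(\Pi_A^{|A|^{n-1}},\,C_{|A|^{n-1}}\bigr).\] Hence there are only finitely many clonoids with source set $A$ and target algebra $\mathbf{B}$.
   Context: $\mathbb{N}=\{1,2,\dots\}$ and $[k]=\{1,\dots,k\}$. An algebra $\mathbf{B}=(B,\mathcal{F})$ is a set $B$ with a (possibly empty, possibly infinite) set $\mathcal{F}$ of finitary operations on $B$; its term operations are the operations obtained from projections and $\mathcal{F}$ by composition. Minors: for $f\colon A^k\to B$, $\ell\in\mathbb{N}$ and $\sigma\colon[k]\to[\ell]$, the function $f^\sigma\colon A^\ell\to B$, $(x_1,\dots,x_\ell)\mapsto f(x_{\sigma(1)},\dots,x_{\sigma(k)})$ is a minor of $f$. Clonoids: for $C\subseteq\bigcup_{n\in\mathbb{N}}B^{A^n}$ let $C_k:=C\cap B^{A^k}$. $C$ is a clonoid with source set $A$ and target algebra $\mathbf{B}$ if $C$ is closed under taking minors and, for all $k\in\mathbb{N}$, $C_k$ is a subalgebra of $\mathbf{B}^{A^k}$ (i.e. closed under the pointwise operations of $\mathbf{B}$; the empty set is allowed). NU-terms: an $n$-ary NU-term ($n\ge3$) of $\mathbf{B}$ is an $n$-ary term operation $f$ with $f(y,x,x,\dots,x)=f(x,y,x,\dots,x)=\dots=f(x,\dots,x,y)=x$ for all $x,y\in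 B$. Polymorphisms: for relations $P\subseteq A^r$, $Q\subseteq B^r$, a function $f\colon A^k\to B$ is a polymorphism of $(P,Q)$ if $f$ applied componentwise to any $k$-tuple of elements of $P$ gives an element of $Q$; $\mathrm{Pol}(P,Q)$ is the set of all such functions of all arities $k\in\mathbb{N}$. Functions as tuples: for $m\in\mathbb{N}$, $\Pi_A^m$ denotes the set of all $m$-ary projections $A^m\to A$. Fixing an enumeration of $A^m$, functions $A^m\to A$ and $A^m\to B$ are identified with tuples of length $|A|^m$ over $A$ and $B$, respectively, so that $\Pi_A^m\subseteq A^{A^m}$ and $C_m\subseteq B^{A^m}$ are regarded as $|A|^m$-ary relations on $A$ and $B$. Here this is used with $m=|A|^{n-1}$. *)

theory Defs
  imports Main "HOL-Library.FuncSet" "HOL-Library.NList"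
begin

text \<open>
  The power \<open>A\<^sup>k\<close> is \<^term>\<open>nlists k A\<close>, and coordinates are numbered from \<open>0\<close>, so \<open>[k]\<close> is
  \<^term>\<open>{..<k}\<close>. A function \<open>A\<^sup>k \<rightarrow> B\<close> is an element of \<^term>\<open>nlists k A \<rightarrow>\<^sub>E B\<close>; sets of
  functions of several arities consist of pairs of an arity and a function, because an
  extensional function alone does not determine its arity: if \<^term>\<open>undefined\<close> lies in \<open>B\<close>,
  the constant functions with this value of all arities coincide.
\<close>

type_synonym ('a, 'b) arity_fun = "nat \<times> ('a list \<Rightarrow> 'b)"

definition finitary_funs :: "'a set \<Rightarrow> 'b set \<Rightarrow> ('a, 'b) arity_fun set" where
  "finitary_funs A B = (SIGMA k:{1..}. nlists k A \<rightarrow>\<^sub>E B)"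

definition layer :: "('a, 'b) arity_fun set \<Rightarrow> nat \<Rightarrow> ('a list \<Rightarrow> 'b) set" where
  "layer C k = {f. (k, f) \<in> C}"

definition projections :: "'a set \<Rightarrow> nat \<Rightarrow> ('a list \<Rightarrow> 'a) set" where
  "projections A m = {\<lambda>xs\<in>nlists m A. xs ! i | i. i < m}"

text \<open>Basic operations may be nullary.\<close>

definition algebra :: "'b set \<Rightarrow> ('b, 'b) arity_fun set \<Rightarrow> bool" where
  "algebra B F \<longleftrightarrow> F \<subseteq> (SIGMA k:UNIV. nlists k B \<rightarrow>\<^sub>E B)"

text \<open>
  The function \<open>x \<mapsto> g(f\<^sub>1(x), \<dots>, f\<^sub>r(x))\<close> on \<open>I\<close>: for \<open>I = B\<^sup>k\<close> this is the composition of \<open>g\<close>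
  with \<open>k\<close>-ary operations, and in general it is the operation of \<open>B\<^sup>I\<close> induced by \<open>g\<close>.
\<close>

definition pointwise :: "'i set \<Rightarrow> ('b list \<Rightarrow> 'b) \<Rightarrow> ('i \<Rightarrow> 'b) list \<Rightarrow> 'i \<Rightarrow> 'b" where
  "pointwise I g fs = (\<lambda>x\<in>I. g (map (\<lambda>f. f x) fs))"

definition subalgebra_of_power ::
    "'i set \<Rightarrow> 'b set \<Rightarrow> ('b, 'b) arity_fun set \<Rightarrow> ('i \<Rightarrow> 'b) set \<Rightarrow> bool" where
  "subalgebra_of_power I B F S \<longleftrightarrow>
     S \<subseteq> (I \<rightarrow>\<^sub>E B) \<and> (\<forall>(r, g)\<in>F. \<forall>fs\<in>nlists r S. pointwise I g fs \<in> S)"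

inductive_set term_operations :: "'b set \<Rightarrow> ('b, 'b) arity_fun set \<Rightarrow> ('b, 'b) arity_fun set"
  for B :: "'b set" and F :: "('b, 'b) arity_fun set" where
  projection: "p \<in> projections B k \<Longrightarrow> (k, p) \<in> term_operations B F"
| basic: "(k, g) \<in> F \<Longrightarrow> (k, g) \<in> term_operations B F"
| composition: "(r, g) \<in> term_operations B F \<Longrightarrow> length fs = r \<Longrightarrow>
    (\<forall>f\<in>set fs. (k, f) \<in> term_operations B F) \<Longrightarrow>
    (k, pointwise (nlists k B) g fs) \<in> term_operations B F"

definition NU_term ::
    "'b set \<Rightarrow> ('b, 'b) arity_fun set \<Rightarrow> nat \<Rightarrow> ('b list \<Rightarrow> 'b) \<Rightarrow> bool" where
  "NU_term B F n f \<longleftrightarrow> n \<ge> 3 \<and> (n, f) \<in> term_operations B F \<and>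
     (\<forall>x\<in>B. \<forall>y\<in>B. \<forall>i<n. f ((replicate n x)[i := y]) = x)"

definition minor ::
    "'a set \<Rightarrow> nat \<Rightarrow> nat \<Rightarrow> (nat \<Rightarrow> nat) \<Rightarrow> ('a list \<Rightarrow> 'b) \<Rightarrow> 'a list \<Rightarrow> 'b" where
  "minor A k l \<sigma> f = (\<lambda>xs\<in>nlists l A. f (map (\<lambda>i. xs ! \<sigma> i) [0..<k]))"

definition clonoid ::
    "'a set \<Rightarrow> 'b set \<Rightarrow> ('b, 'b) arity_fun set \<Rightarrow> ('a, 'b) arity_fun set \<Rightarrow> bool" where
  "clonoid A B F C \<longleftrightarrow>
     C \<subseteq> finitary_funs A B \<and>
     (\<forall>(k, f)\<in>C. \<forall>l\<ge>1. \<forall>\<sigma>\<in>{..<k} \<rightarrow> {..<l}. (l, minor A k l \<sigma> f) \<in> C) \<and>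
     (\<forall>k\<ge>1. subalgebra_of_power (nlists k A) B F (layer C k))"

text \<open>
  \<open>Pol A B r P Q\<close> is \<open>Pol(P, Q)\<close> for \<open>r\<close>-ary relations \<open>P\<close> on \<open>A\<close> and \<open>Q\<close> on \<open>B\<close>.
\<close>

definition Pol ::
    "'a set \<Rightarrow> 'b set \<Rightarrow> nat \<Rightarrow> 'a list set \<Rightarrow> 'b list set \<Rightarrow> ('a, 'b) arity_fun set" where
  "Pol A B r P Q = {(k, f) \<in> finitary_funs A B.
     \<forall>ps\<in>nlists k P. map (\<lambda>i. f (map (\<lambda>p. p ! i) ps)) [0..<r] \<in> Q}"

definition enumeration :: "'i list \<Rightarrow> 'i set \<Rightarrow> bool" where
  "enumeration es I \<longleftrightarrow> distinct es \<and> set es = I"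

text \<open>A set of functions on \<open>I\<close>, read as a relation along an enumeration \<open>es\<close> of \<open>I\<close>.\<close>

definition as_relation :: "'i list \<Rightarrow> ('i \<Rightarrow> 'c) set \<Rightarrow> 'c list set" where
  "as_relation es S = (\<lambda>f. map f es) ` S"

end

theory Submission imports Defs begin

text \<open>
  The inclusion of \<open>C\<close> in the polymorphism set is closure under minors. Conversely, all minors of
  arity \<open>|A|\<^bsup>n-1\<^esup>\<close> of a polymorphism \<open>f\<close> lie in \<open>C\<close>. Given \<open>n - 1\<close> points of \<open>A\<^sup>k\<close>, at most
  \<open>|A|\<^bsup>n-1\<^esup>\<close> different columns occur in the matrix whose rows they are; identifying the variables
  of \<open>f\<close> with equal columns does not change \<open>f\<close> at these points, and the result, being a minor
  of a minor of arity \<open>|A|\<^bsup>n-1\<^esup>\<close>, lies in \<open>C\<close>. So \<open>f\<close> is interpolated by \<open>C\<close> on any \<open>n - 1\<close>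
  points, and the argument of Baker and Pixley with the NU-term yields interpolation on all of
  \<open>A\<^sup>k\<close>. Finiteness follows because \<open>C\<close> is determined by one of its finitely many possible layers.
\<close>

text \<open>As simplification rules these two loop together with the characterisation that follows.\<close>

declare nlistsE_length [simp del] nlistsE_set [simp del]

lemma nlists_iff: "xs \<in> nlists k A \<longleftrightarrow> length xs = k \<and> set xs \<subseteq> A"
  by (auto simp: nlists_def)

lemma finite_nlists: "finite A \<Longrightarrow> finite (nlists k A)"
  using finite_lists_length_eq[of A k] by (simp add: nlists_def conj_commute)

lemma card_nlists: "finite A \<Longrightarrow> card (nlists k A) = card A ^ k"
  using card_lists_length_eq[of A k] by (simp add: nlists_def conj_commute)

section \<open>Term operations and subalgebras of powers\<close>

lemma term_operation_in_funs:
  assumes "algebra B F" "(r, g) \<in> term_operations B F"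
  shows "g \<in> nlists r B \<rightarrow>\<^sub>E B"
  using assms(2)
proof (induction rule: term_operations.induct)
  case (projection p k)
  then show ?case by (auto simp: projections_def nlistsE_nth_in)
next
  case (basic k g)
  with assms(1) show ?case by (auto simp: algebra_def)
next
  case (composition r g fs k)
  then have "map (\<lambda>f. f x) fs \<in> nlists r B" if "x \<in> nlists k B" for x
    using that by (auto simp: nlists_iff[of _ r])
  with composition.IH(1) show ?case by (auto simp: pointwise_def)
qed

text \<open>The NU-term need not be a basic operation, so closure is carried from \<open>F\<close>
  to all term operations by induction. \<open>fs\<close> is generalised because in a composition the
  outer operation acts on the tuple of results of the inner ones.\<close>

lemma pointwise_term_operation_in_subalgebra:
  assumes "algebra B F" "subalgebra_of_power I B F S"
    and "(r, g) \<in> term_operations B F" "fs \<in> nlists r S"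
  shows "pointwise I g fs \<in> S"
  using assms(3,4)
proof (induction arbitrary: fs rule: term_operations.induct)
  case (projection p k)
  then obtain i where i: "i < k" "p = (\<lambda>xs\<in>nlists k B. xs ! i)"
    by (auto simp: projections_def)
  have S: "S \<subseteq> I \<rightarrow>\<^sub>E B"
    using assms(2) by (simp add: subalgebra_of_power_def)
  have len: "length fs = k" and fi: "fs ! i \<in> S" and sub: "set fs \<subseteq> S"
    using projection i by (auto simp: nlists_iff)
  have "pointwise I p fs = fs ! i"
  proof
    fix x
    show "pointwise I p fs x = (fs ! i) x"
    proof (cases "x \<in> I")
      case True
      then have "map (\<lambda>f. f x) fs \<in> nlists k B"
        using S sub len by (auto simp: nlists_iff)
      with True i len show ?thesis by (simp add: pointwise_def)
    next
      \<comment> \<open>Members of \<open>S\<close> are extensional, so both sides are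
        \<open>undefined\<close> off \<open>I\<close>.\<close>
      case False
      with S fi have "(fs ! i) x = undefined" by (meson PiE_arb subsetD)
      with False show ?thesis by (simp add: pointwise_def)
    qed
  qed
  with fi show ?case by simp
next
  case (basic k g)
  then show ?case using assms(2) by (auto simp: subalgebra_of_power_def)
next
  case (composition r g gs k)
  have S: "S \<subseteq> I \<rightarrow>\<^sub>E B"
    using assms(2) by (simp add: subalgebra_of_power_def)
  have "map (\<lambda>f. pointwise I f fs) gs \<in> nlists r S"
    using composition by (auto simp: nlists_iff)
  then have "pointwise I g (map (\<lambda>f. pointwise I f fs) gs) \<in> S"
    by (rule composition.IH)
  moreover have "map (\<lambda>f. f x) fs \<in> nlists k B" if "x \<in> I" for x
    using that S composition.prems by (auto simp: nlists_iff)
  then have "pointwise I (pointwise (nlists k B) g gs) fs =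
      pointwise I g (map (\<lambda>f. pointwise I f fs) gs)"
    by (auto simp: pointwise_def comp_def intro!: restrict_ext arg_cong[of _ _ g])
  ultimately show ?case by simp
qed

section \<open>Near-unanimity and interpolation\<close>

text \<open>A tuple that is constant off \<open>j\<close> is the constant tuple updated at
  \<open>j\<close> by its own entry. That entry may itself be \<open>x\<close>, which covers the
  unanimous case.\<close>

lemma NU_term_near_unanimity:
  assumes "NU_term B F n t" and "length ys = n" "set ys \<subseteq> B" "x \<in> B"
    and "j < n" "\<And>i. i < n \<Longrightarrow> i \<noteq> j \<Longrightarrow> ys ! i = x"
  shows "t ys = x"
proof -
  have "ys = (replicate n x)[j := ys ! j]"
    using assms by (auto intro!: nth_equalityI simp: nth_list_update)
  moreover have "ys ! j \<in> B" using assms by auto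
  ultimately show ?thesis
    using assms by (metis NU_term_def)
qed

text \<open>Induction on the size of \<open>T\<close>. If \<open>T\<close> has at least
  \<open>n\<close> points, drop each of \<open>n\<close> chosen points in turn. At every point of
  \<open>T\<close> at most one of the \<open>n\<close> resulting interpolants differs from
  \<open>f\<close>, and the NU-term outvotes it.\<close>

lemma Baker_Pixley_interpolation:
  assumes alg: "algebra B F" and sub: "subalgebra_of_power I B F S" and nu: "NU_term B F n t"
    and f: "f \<in> I \<rightarrow> B"
    and local: "\<And>T. finite T \<Longrightarrow> T \<subseteq> I \<Longrightarrow> card T < n \<Longrightarrow> \<exists>g\<in>S. \<forall>x\<in>T. g x = f x"
    and "finite T" "T \<subseteq> I"
  shows "\<exists>g\<in>S. \<forall>x\<in>T. g x = f x"
  using \<open>finite T\<close> \<open>T \<subseteq> I\<close>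
proof (induction "card T" arbitrary: T rule: less_induct)
  case less
  show ?case
  proof (cases "card T < n")
    case True
    with less.prems local show ?thesis by blast
  next
    case False
    have S: "S \<subseteq> I \<rightarrow>\<^sub>E B"
      using sub by (simp add: subalgebra_of_power_def)
    obtain ps where ps: "distinct ps" "set ps = T"
      using finite_distinct_list[OF less.prems(1)] by blast
    with False have len: "n \<le> length ps"
      by (metis distinct_card not_less)
    have "\<exists>g\<in>S. \<forall>x\<in>T - {ps ! i}. g x = f x" if "i < n" for i
    proof -
      have "ps ! i \<in> T" using ps len that by auto
      then have "card (T - {ps ! i}) < card T"
        using less.prems(1) by (meson card_Diff1_less)
      with less.prems show ?thesis by (intro less.hyps) auto
    qed
    then obtain g where g: "\<And>i. i < n \<Longrightarrow> g i \<in> S"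
      "\<And>i x. i < n \<Longrightarrow> x \<in> T \<Longrightarrow> x \<noteq> ps ! i \<Longrightarrow> g i x = f x"
      by (metis DiffI singletonD)
    define h where "h = pointwise I t (map g [0..<n])"
    have t: "(n, t) \<in> term_operations B F" and n: "n \<ge> 3"
      using nu by (auto simp: NU_term_def)
    have "h \<in> S" unfolding h_def
      by (rule pointwise_term_operation_in_subalgebra[OF alg sub t]) (auto simp: nlists_iff g)
    moreover have "h x = f x" if x: "x \<in> T" for x
    proof -
      \<comment> \<open>\<open>j\<close> is the position of \<open>x\<close> among the
        \<open>n\<close> chosen points. If \<open>x\<close> is none of them, every
        \<open>g i\<close> is correct at \<open>x\<close> and any index serves, here
        \<open>0\<close>.\<close>
      obtain j where j: "j < n" "\<And>i. i < n \<Longrightarrow> i \<noteq> j \<Longrightarrow> x \<noteq> ps ! i"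
      proof (cases "\<exists>j<n. x = ps ! j")
        case True
        then obtain j where "j < n" "x = ps ! j" by blast
        then show ?thesis
          using that[of j] ps len by (auto simp: nth_eq_iff_index_eq)
      next
        case False
        then show ?thesis using that[of 0] n by auto
      qed
      have "x \<in> I" using x less.prems by auto
      then have "h x = t (map (\<lambda>i. g i x) [0..<n])"
        by (simp add: h_def pointwise_def comp_def)
      also have "\<dots> = f x"
      proof (rule NU_term_near_unanimity[OF nu _ _ _ j(1)])
        show "set (map (\<lambda>i. g i x) [0..<n]) \<subseteq> B"
          using g(1) S \<open>x \<in> I\<close> by fastforce
        show "f x \<in> B" using f \<open>x \<in> I\<close> by auto
      qed (use g(2) x j in auto)
      finally show ?thesis .
    qed
    ultimately show ?thesis by blast
  qed
qed

section \<open>Polymorphisms of projections and minors\<close>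

text \<open>An extensional function is recoverable from its values along \<open>es\<close>, so
  membership in the relation \<open>as_relation es L\<close> can be traced back to membership in
  \<open>L\<close>.\<close>

lemma inj_on_map_enumeration:
  assumes "enumeration es I"
  shows "inj_on (\<lambda>f. map f es) (I \<rightarrow>\<^sub>E B)"
proof (rule inj_onI)
  fix f g assume "f \<in> I \<rightarrow>\<^sub>E B" "g \<in> I \<rightarrow>\<^sub>E B" "map f es = map g es"
  then show "f = g"
    using assms by (auto simp: enumeration_def intro: PiE_ext)
qed

lemma minor_in_funs:
  assumes "f \<in> nlists k A \<rightarrow>\<^sub>E B" "\<sigma> \<in> {..<k} \<rightarrow> {..<l}"
  shows "minor A k l \<sigma> f \<in> nlists l A \<rightarrow>\<^sub>E B"
proof -
  have "map (\<lambda>i. xs ! \<sigma> i) [0..<k] \<in> nlists k A" if "xs \<in> nlists l A" for xs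
    using that assms(2) by (auto simp: nlists_iff Pi_iff)
  with assms(1) show ?thesis by (auto simp: minor_def)
qed

text \<open>
  A \<open>k\<close>-tuple of \<open>m\<close>-ary projections amounts to a map \<open>[k] \<rightarrow> [m]\<close>, the index map of a minor.
\<close>

lemma Pol_projections_iff_minors:
  assumes es: "enumeration es (nlists m A)" and r: "r = length es"
    and L: "L \<subseteq> nlists m A \<rightarrow>\<^sub>E B"
  shows "(k, f) \<in> Pol A B r (as_relation es (projections A m)) (as_relation es L) \<longleftrightarrow>
    (k, f) \<in> finitary_funs A B \<and> (\<forall>\<sigma>\<in>{..<k} \<rightarrow> {..<m}. minor A k m \<sigma> f \<in> L)"
proof (cases "(k, f) \<in> finitary_funs A B")
  case True
  then have f: "f \<in> nlists k A \<rightarrow>\<^sub>E B" by (simp add: finitary_funs_def)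
  define pr where "pr i = map (\<lambda>xs\<in>nlists m A. xs ! i) es" for i
  have rel: "as_relation es (projections A m) = pr ` {..<m}"
    by (auto simp: as_relation_def projections_def pr_def)
  have es_mem: "es ! i \<in> nlists m A" if "i < r" for i
    using es nth_mem[of i es] that unfolding r enumeration_def by simp
  \<comment> \<open>Entry \<open>i\<close> of \<open>pr (\<sigma> j)\<close> is
    \<open>es ! i ! \<sigma> j\<close>, so \<open>f\<close> applied componentwise lists the values
    of the minor along \<open>es\<close>.\<close>
  have applied: "map (\<lambda>i. f (map (\<lambda>p. p ! i) ps)) [0..<r] = map (minor A k m \<sigma> f) es"
    if "ps = map (\<lambda>j. pr (\<sigma> j)) [0..<k]" for ps \<sigma>
    using that es_mem r
    by (auto intro!: nth_equalityI arg_cong[of _ _ f] simp: pr_def minor_def)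
  have mem: "map (minor A k m \<sigma> f) es \<in> as_relation es L \<longleftrightarrow> minor A k m \<sigma> f \<in> L"
    if "\<sigma> \<in> {..<k} \<rightarrow> {..<m}" for \<sigma>
    unfolding as_relation_def
    using inj_on_image_mem_iff[OF inj_on_map_enumeration[OF es] minor_in_funs[OF f that] L] .
  have tuples: "ps \<in> nlists k (pr ` {..<m}) \<longleftrightarrow>
      (\<exists>\<sigma>\<in>{..<k} \<rightarrow> {..<m}. ps = map (\<lambda>j. pr (\<sigma> j)) [0..<k])" for ps
  proof
    assume ps: "ps \<in> nlists k (pr ` {..<m})"
    then have "\<forall>j\<in>{..<k}. \<exists>i. i < m \<and> ps ! j = pr i"
      by (auto simp: nlists_iff dest!: subsetD[OF _ nth_mem])
    then obtain \<sigma> where "\<forall>j\<in>{..<k}. \<sigma> j < m \<and> ps ! j = pr (\<sigma> j)" by metis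
    with ps show "\<exists>\<sigma>\<in>{..<k} \<rightarrow> {..<m}. ps = map (\<lambda>j. pr (\<sigma> j)) [0..<k]"
      by (intro bexI[of _ \<sigma>]) (auto intro!: nth_equalityI simp: nlists_iff)
  qed (auto simp: nlists_iff Pi_iff)
  have "(\<forall>ps\<in>nlists k (pr ` {..<m}).
        map (\<lambda>i. f (map (\<lambda>p. p ! i) ps)) [0..<r] \<in> as_relation es L) \<longleftrightarrow>
      (\<forall>\<sigma>\<in>{..<k} \<rightarrow> {..<m}. minor A k m \<sigma> f \<in> L)"
    (is "?P \<longleftrightarrow> ?M")
  proof
    assume P: ?P
    show ?M
    proof
      fix \<sigma> :: "nat \<Rightarrow> nat" assume \<sigma>: "\<sigma> \<in> {..<k} \<rightarrow> {..<m}"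
      define ps where "ps = map (\<lambda>j. pr (\<sigma> j)) [0..<k]"
      have "ps \<in> nlists k (pr ` {..<m})"
        unfolding tuples using \<sigma> ps_def by blast
      with P have "map (\<lambda>i. f (map (\<lambda>p. p ! i) ps)) [0..<r] \<in> as_relation es L" ..
      then show "minor A k m \<sigma> f \<in> L"
        unfolding applied[OF ps_def] mem[OF \<sigma>] .
    qed
  next
    assume M: ?M
    show ?P
    proof
      fix ps assume "ps \<in> nlists k (pr ` {..<m})"
      then obtain \<sigma> where \<sigma>: "\<sigma> \<in> {..<k} \<rightarrow> {..<m}" and ps: "ps = map (\<lambda>j. pr (\<sigma> j)) [0..<k]"
        unfolding tuples by blast
      show "map (\<lambda>i. f (map (\<lambda>p. p ! i) ps)) [0..<r] \<in> as_relation es L"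
        unfolding applied[OF ps] mem[OF \<sigma>] using M \<sigma> ..
    qed
  qed
  with True show ?thesis by (simp add: Pol_def rel)
qed (simp add: Pol_def)

section \<open>Identification of variables with equal columns\<close>

text \<open>\<open>\<sigma>\<close> numbers the columns of the matrix whose rows are the points of
  \<open>T\<close>, and \<open>\<tau>\<close> leads from a number back to a variable with that
  column. Following \<open>\<sigma>\<close> by \<open>\<tau>\<close> thus only exchanges variables
  with equal columns.\<close>

lemma interpolation_by_minor_of_minor:
  assumes A: "finite A" and k: "k \<ge> 1" and T: "finite T" "T \<subseteq> nlists k A" "card T \<le> d"
    and "card A \<ge> 1"
  obtains \<sigma> \<tau> where "\<sigma> \<in> {..<k} \<rightarrow> {..<card A ^ d}" "\<tau> \<in> {..<card A ^ d} \<rightarrow> {..<k}"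
    "\<And>x. x \<in> T \<Longrightarrow> minor A (card A ^ d) k \<tau> (minor A k (card A ^ d) \<sigma> f) x = f x"
proof -
  let ?m = "card A ^ d"
  obtain ts where ts: "set ts = T" "length ts = card T"
    using finite_distinct_list[OF T(1)] distinct_card by metis
  define column where "column j = map (\<lambda>x. x ! j) ts" for j
  have column_mem: "column j \<in> nlists (card T) A" if "j < k" for j
    using that ts T(2) by (fastforce simp: nlists_iff column_def)
  \<comment> \<open>Room for all possible columns; \<open>card A \<ge> 1\<close> makes the powers of
    \<open>card A\<close> monotone in the exponent.\<close>
  have "card (nlists (card T) A) \<le> card {..<?m}"
    using T(3) \<open>card A \<ge> 1\<close> by (simp add: card_nlists[OF A] power_increasing)
  then obtain \<phi> where \<phi>: "\<phi> ` nlists (card T) A \<subseteq> {..<?m}" "inj_on \<phi> (nlists (card T) A)"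
    using card_le_inj[OF finite_nlists[OF A] finite_lessThan] by blast
  define \<sigma> where "\<sigma> j = \<phi> (column j)" for j
  \<comment> \<open>Indices that number no column get the value \<open>0\<close>, which is below
    \<open>k\<close> because \<open>k \<ge> 1\<close>.\<close>
  define \<tau> where "\<tau> i = (if i \<in> \<sigma> ` {..<k} then inv_into {..<k} \<sigma> i else 0)" for i
  have \<tau>\<sigma>: "\<tau> (\<sigma> j) < k" "\<sigma> (\<tau> (\<sigma> j)) = \<sigma> j" if "j < k" for j
    using that inv_into_into[of "\<sigma> j" \<sigma> "{..<k}"] f_inv_into_f[of "\<sigma> j" \<sigma> "{..<k}"]
    by (auto simp: \<tau>_def)
  have \<sigma>: "\<sigma> \<in> {..<k} \<rightarrow> {..<?m}"
    using \<phi>(1) column_mem by (fastforce simp: \<sigma>_def)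
  have \<tau>: "\<tau> \<in> {..<?m} \<rightarrow> {..<k}"
  proof
    fix i
    show "\<tau> i \<in> {..<k}"
      using inv_into_into[of i \<sigma> "{..<k}"] k by (auto simp: \<tau>_def)
  qed
  have same: "x ! \<tau> (\<sigma> j) = x ! j" if "x \<in> T" "j < k" for x j
  proof -
    have "column (\<tau> (\<sigma> j)) = column j"
      using \<tau>\<sigma>[OF that(2)] \<phi>(2) column_mem that(2) by (auto simp: \<sigma>_def dest: inj_onD)
    with that(1) ts(1) show ?thesis by (auto simp: column_def)
  qed
  have "minor A ?m k \<tau> (minor A k ?m \<sigma> f) x = f x" if x: "x \<in> T" for x
  proof -
    have xk: "x \<in> nlists k A" using x T(2) by auto
    then have "map (\<lambda>i. x ! \<tau> i) [0..<?m] \<in> nlists ?m A"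
      using \<tau> by (auto simp: nlists_iff Pi_iff)
    moreover have "map (\<lambda>j. map (\<lambda>i. x ! \<tau> i) [0..<?m] ! \<sigma> j) [0..<k] = x"
      using same[OF x] xk \<sigma> by (auto intro!: nth_equalityI simp: nlists_iff Pi_iff)
    ultimately show ?thesis using xk by (simp add: minor_def)
  qed
  with \<sigma> \<tau> that show ?thesis by blast
qed

section \<open>Clonoids and their layers\<close>

lemma clonoid_layer_subset:
  assumes "clonoid A B F C"
  shows "layer C k \<subseteq> nlists k A \<rightarrow>\<^sub>E B"
  using assms by (auto simp: clonoid_def layer_def finitary_funs_def)

lemma clonoid_minor:
  assumes "clonoid A B F C" "(k, f) \<in> C" "l \<ge> 1" "\<sigma> \<in> {..<k} \<rightarrow> {..<l}"
  shows "(l, minor A k l \<sigma> f) \<in> C"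
  using assms by (auto simp: clonoid_def)

text \<open>This is the equality with the polymorphism set freed from relations and enumerations. In
  this form it also shows that a single layer determines \<open>C\<close>.\<close>

lemma clonoid_iff_minors_in_layer:
  assumes A: "finite A" "card A \<ge> 1" and alg: "algebra B F" and nu: "NU_term B F n t"
    and C: "clonoid A B F C"
  shows "(k, f) \<in> C \<longleftrightarrow> (k, f) \<in> finitary_funs A B \<and>
    (\<forall>\<sigma>\<in>{..<k} \<rightarrow> {..<card A ^ (n - 1)}.
      minor A k (card A ^ (n - 1)) \<sigma> f \<in> layer C (card A ^ (n - 1)))" (is "_ \<longleftrightarrow> ?R")
proof
  assume "(k, f) \<in> C"
  with C clonoid_minor[OF C this] A(2) show ?R
    by (auto simp: clonoid_def layer_def)
next
  let ?m = "card A ^ (n - 1)"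
  assume R: ?R
  then have k: "k \<ge> 1" and f: "f \<in> nlists k A \<rightarrow>\<^sub>E B" by (auto simp: finitary_funs_def)
  have sub: "subalgebra_of_power (nlists k A) B F (layer C k)"
    using C k by (simp add: clonoid_def)
  have "\<exists>g\<in>layer C k. \<forall>x\<in>nlists k A. g x = f x"
  proof (rule Baker_Pixley_interpolation[OF alg sub nu _ _ finite_nlists[OF A(1)]])
    fix T assume T: "finite T" "T \<subseteq> nlists k A" "card T < n"
    then have "card T \<le> n - 1" by simp
    then obtain \<sigma> \<tau> where \<sigma>\<tau>: "\<sigma> \<in> {..<k} \<rightarrow> {..<?m}" "\<tau> \<in> {..<?m} \<rightarrow> {..<k}"
      "\<And>x. x \<in> T \<Longrightarrow> minor A ?m k \<tau> (minor A k ?m \<sigma> f) x = f x"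
      using interpolation_by_minor_of_minor[OF A(1) k T(1,2) _ A(2)] by blast
    have "(?m, minor A k ?m \<sigma> f) \<in> C" using R \<sigma>\<tau>(1) by (simp add: layer_def)
    from clonoid_minor[OF C this k \<sigma>\<tau>(2)] \<sigma>\<tau>(3)
    show "\<exists>g\<in>layer C k. \<forall>x\<in>T. g x = f x" by (auto simp: layer_def)
  qed (use f in auto)
  then obtain g where "g \<in> layer C k" "\<forall>x\<in>nlists k A. g x = f x" by blast
  \<comment> \<open>Both functions are extensional on \<open>nlists k A\<close>, so agreement there
    is equality.\<close>
  moreover from this f clonoid_layer_subset[OF C] have "g = f"
    by (meson PiE_ext subsetD)
  ultimately show "(k, f) \<in> C" by (simp add: layer_def)
qed

theorem theorem2p1:
  fixes A :: "'a set" and B :: "'b set" and F :: "('b, 'b) arity_fun set" and n :: nat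
  assumes "finite A" and "card A > 1"
    and "finite B" and "algebra B F"
    and "n \<ge> 3" and "\<exists>t. NU_term B F n t"
  shows "(\<forall>C es. clonoid A B F C \<longrightarrow> enumeration es (nlists (card A ^ (n - 1)) A) \<longrightarrow>
            C = Pol A B (card A ^ (card A ^ (n - 1)))
                  (as_relation es (projections A (card A ^ (n - 1))))
                  (as_relation es (layer C (card A ^ (n - 1)))))
         \<and> finite {C :: ('a, 'b) arity_fun set. clonoid A B F C}"
proof -
  let ?m = "card A ^ (n - 1)"
  obtain t where nu: "NU_term B F n t" using assms(6) by blast
  have iff: "(k, f) \<in> C \<longleftrightarrow> (k, f) \<in> finitary_funs A B \<and>
      (\<forall>\<sigma>\<in>{..<k} \<rightarrow> {..<?m}. minor A k ?m \<sigma> f \<in> layer C ?m)"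
    if "clonoid A B F C" for C :: "('a, 'b) arity_fun set" and k f
    using clonoid_iff_minors_in_layer[OF assms(1) _ assms(4) nu that] assms(2) by simp
  have "C = Pol A B (card A ^ ?m) (as_relation es (projections A ?m)) (as_relation es (layer C ?m))"
    if C: "clonoid A B F C" and es: "enumeration es (nlists ?m A)" for C es
  proof -
    \<comment> \<open>The relations have one coordinate for each point of
      \<open>nlists ?m A\<close>, which fixes their arity.\<close>
    have "card A ^ ?m = length es"
      using es distinct_card[of es] card_nlists[OF assms(1), of ?m] by (simp add: enumeration_def)
    from iff[OF C] Pol_projections_iff_minors[OF es this clonoid_layer_subset[OF C]]
    show ?thesis by (intro set_eqI) (metis prod.exhaust)
  qed
  moreover have "finite {C :: ('a, 'b) arity_fun set. clonoid A B F C}"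
  proof (rule inj_on_finite)
    \<comment> \<open>By \<open>iff\<close> a clonoid is recovered from its layer of arity
      \<open>?m\<close>, and only finitely many sets can be such a layer.\<close>
    show "inj_on (\<lambda>C. layer C ?m) {C. clonoid A B F C}"
    proof (rule inj_onI)
      fix C D :: "('a, 'b) arity_fun set"
      assume CD: "C \<in> {C. clonoid A B F C}" "D \<in> {C. clonoid A B F C}" "layer C ?m = layer D ?m"
      then have "(k, f) \<in> C \<longleftrightarrow> (k, f) \<in> D" for k f
        using iff[of C k f] iff[of D k f] by simp
      then show "C = D" by auto
    qed
    show "(\<lambda>C. layer C ?m) ` {C. clonoid A B F C} \<subseteq> Pow (nlists ?m A \<rightarrow>\<^sub>E B)"
      using clonoid_layer_subset by blast
    show "finite (Pow (nlists ?m A \<rightarrow>\<^sub>E B))"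
      using assms by (simp add: finite_PiE finite_nlists)
  qed
  ultimately show ?thesis by blast
qed

end
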